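(* Let $\omega=\omega(n)$ be a nondecreasing, integer-valued function tending to infinity, and let $\eta(n)\to 0$. Consider vertex-transitive graphs $G$ of order $n$ with degree $m$ satisfying $$m\cdot\mathrm{diam}(G)\ \ge\ 3\,\omega\, 2^{(1-\eta(n))\sqrt{\log_2 n}}\,\sqrt{\log_2 n}.$$ (1) If $\omega=\Omega\bigl(2^{\sqrt{\log_2 n}}\bigr)$, then there is a function $\eta_1(n)\to 0$ such that for all sufficiently large $n$ and all such $G$, $$c(G)\ \le\ \frac{n}{2^{(1-\eta_1(n))\sqrt{\log_2 n}}}\cdot\frac{3\log\omega}{3\omega\sqrt{\log_2 n}},$$ and the right-hand side is $o\!\left(\dfrac{n}{2^{(1-\eta_1(n))\sqrt{\log_2 n}}}\right)$. (2) If $\omega=o\bigl(2^{\sqrt{\log_2 n}}\bigr)$, then there are functions $\eta_2(n)\to 0$ and $\theta(n)\to 0$ such that for all sufficiently large $n$ and all such $G$, $$c(G)\ \le\ \frac{n}{2^{(1-\eta_2(n))\sqrt{\log_2 n}}}\cdot\frac{1-\theta(n)}{3\omega},$$ and the right-hand side is $o\!\left(\dfrac{n}{2^{(1-\eta_2(n))\sqrt{\log_2 n}}}\right)$.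
   Context: All graphs are finite, simple, undirected and connected; logarithms are base $2$. A graph is vertex-transitive if for every two vertices $x,y$ there is an automorphism mapping $x$ to $y$; such a graph is $m$-regular for some $m$, called its degree. $\mathrm{diam}(G)$ is the diameter of $G$. Cops and Robbers on a graph $G$: in round $0$ the cops choose vertices to occupy, then the robber chooses a vertex. In each later round the cops move first and then the robber. On a move, each player moves to a neighboring vertex or stays put; any subset of the cops may move. Both sides have complete information. The cops win if after finitely many rounds some cop occupies the robber's vertex; otherwise the robber wins. The cop number $c(G)$ is the minimum number of cops that guarantees a win for the cops. *)

theory Defs
  imports "Graph_Theory.Graph_Theory" "HOL-Library.Landau_Symbols"
begin

text \<open>
  A finite simple undirected graph is a \<^locale>\<open>pair_graph\<close>: a finite, loop-free, symmetric
  digraph whose arcs are ordered pairs of vertices. Each edge is a pair of opposite arcs, so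
  \<^const>\<open>out_degree\<close> counts the neighbours of a vertex. The definitions below apply to it
  through the coercion \<^const>\<open>with_proj\<close>.
\<close>

definition automorphism :: "('a, 'b) pre_digraph \<Rightarrow> ('a, 'b, 'a, 'b) digraph_isomorphism \<Rightarrow> bool" where
  "automorphism G h \<longleftrightarrow> pre_digraph.digraph_isomorphism G h \<and> app_iso h G = G"

definition vertex_transitive :: "('a, 'b) pre_digraph \<Rightarrow> bool" where
  "vertex_transitive G \<longleftrightarrow>
     (\<forall>x\<in>verts G. \<forall>y\<in>verts G. \<exists>h. automorphism G h \<and> iso_verts h x = y)"

definition regular :: "('a, 'b) pre_digraph \<Rightarrow> nat \<Rightarrow> bool" where
  "regular G m \<longleftrightarrow> (\<forall>v\<in>verts G. out_degree G v = m)"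

text \<open>
  With unit weights, \<^const>\<open>wf_digraph.\<mu>\<close> is the length of a shortest walk, which is infinite
  if there is none.
\<close>

definition diam :: "('a, 'b) pre_digraph \<Rightarrow> ereal" where
  "diam G = (SUP u\<in>verts G. SUP v\<in>verts G. wf_digraph.\<mu> G (\<lambda>_. 1) u v)"

definition vt_graphs :: "nat \<Rightarrow> nat \<Rightarrow> 'a pair_pre_digraph set" where
  "vt_graphs n m = {G. pair_graph G \<and> Digraph_Component.connected (with_proj G) \<and>
     vertex_transitive (with_proj G) \<and> card (pverts G) = n \<and> regular (with_proj G) m}"

definition legal_move :: "('a, 'b) pre_digraph \<Rightarrow> 'a \<Rightarrow> 'a \<Rightarrow> bool" where
  "legal_move G u v \<longleftrightarrow> u \<in> verts G \<and> v \<in> verts G \<and> (v = u \<or> u \<rightarrow>\<^bsub>G\<^esub> v)"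

text \<open>
  \<open>r t\<close> is the robber's position at the end of round \<open>t\<close>. Requiring the cops to beat every such
  sequence is the same as requiring them to beat every robber strategy.
\<close>

definition robber_play :: "('a, 'b) pre_digraph \<Rightarrow> (nat \<Rightarrow> 'a) \<Rightarrow> bool" where
  "robber_play G r \<longleftrightarrow> r 0 \<in> verts G \<and> (\<forall>t. legal_move G (r t) (r (Suc t)))"

text \<open>
  A strategy \<open>\<sigma>\<close> of \<open>k\<close> cops maps the robber's positions so far to the positions of the cops
  \<open>i < k\<close>: in round \<open>t\<close>, the cops choose \<open>\<sigma> [r 0, \<dots>, r (t - 1)]\<close>, and \<open>\<sigma> []\<close> is their
  initial placement. The cops' own past positions are determined by these data.
\<close>

definition cop_strategy :: "('a, 'b) pre_digraph \<Rightarrow> nat \<Rightarrow> ('a list \<Rightarrow> nat \<Rightarrow> 'a) \<Rightarrow> bool" where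
  "cop_strategy G k \<sigma> \<longleftrightarrow>
     (\<forall>i<k. \<sigma> [] i \<in> verts G) \<and>
     (\<forall>r. robber_play G r \<longrightarrow>
       (\<forall>t. \<forall>i<k. legal_move G (\<sigma> (map r [0..<t]) i) (\<sigma> (map r [0..<Suc t]) i)))"

text \<open>
  The robber is caught after the robber's move in round \<open>t\<close>, or after the cops' move in round
  \<open>Suc t\<close>, when the robber is still at \<open>r t\<close>.
\<close>

definition captured :: "nat \<Rightarrow> ('a list \<Rightarrow> nat \<Rightarrow> 'a) \<Rightarrow> (nat \<Rightarrow> 'a) \<Rightarrow> bool" where
  "captured k \<sigma> r \<longleftrightarrow>
     (\<exists>t. \<exists>i<k. \<sigma> (map r [0..<t]) i = r t \<or> \<sigma> (map r [0..<Suc t]) i = r t)"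

definition cops_win :: "('a, 'b) pre_digraph \<Rightarrow> nat \<Rightarrow> bool" where
  "cops_win G k \<longleftrightarrow>
     (\<exists>\<sigma>. cop_strategy G k \<sigma> \<and> (\<forall>r. robber_play G r \<longrightarrow> captured k \<sigma> r))"

definition cop_number :: "('a, 'b) pre_digraph \<Rightarrow> nat" where
  "cop_number G = (LEAST k. cops_win G k)"

end

theory Submission
  imports Defs "HOL-Real_Asymp.Real_Asymp" "HOL-Combinatorics.Permutations"
begin

text \<open>
  The two parts share one estimate: a connected vertex-transitive graph with \<open>n\<close> vertices, degree
  \<open>m\<close> and diameter \<open>d\<close>, where \<open>m d > 0\<close>, has cop number at most \<open>15 n (1 + ln n) / (m d)\<close>
  (\<open>cop_number_vertex_transitive\<close>). It combines three facts.
  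
  Let \<open>P\<close> be a shortest path of length \<open>d\<close> and \<open>A\<close> the set of neighbours of its vertices. Every
  third vertex of \<open>P\<close> has a neighbourhood disjoint from those of the others, because two vertices
  of \<open>P\<close> with a common neighbour are at distance at most \<open>2\<close>; hence \<open>3 |A| \<ge> m d\<close>
  (\<open>card_nbhd_geodesic\<close>).
  
  Since automorphisms act transitively, an average image of \<open>A\<close> contains the fraction \<open>|A| / n\<close> of
  any given set of vertices. Choosing images greedily, the uncovered set shrinks by the factor
  \<open>1 - |A| / n\<close> each time, so at most \<open>n (1 + ln n) / |A|\<close> images of \<open>A\<close> cover the graph
  (\<open>cover_by_translates\<close>).
  
  Finally, five cops control one image of \<open>A\<close>. The distance \<open>f\<close> of the robber from the start of the
  path changes by at most one per round, so a cop can walk along the path and keep to the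
  vertex with index \<open>f\<close>, or with index \<open>f + c\<close> for a fixed \<open>c\<close>. Five such shadows, with
  \<open>-2 \<le> c \<le> 2\<close>, suffice: if the robber is next to the path vertex with index \<open>j\<close>, then
  \<open>|f - j| \<le> 1\<close>, and the cops lag one robber move behind. As the images of \<open>A\<close>
  cover the graph, the robber is next to a cop as soon as all shadows are in place
  (\<open>cops_win_shadows\<close>).
  
  For the asymptotic statement, the surplus factor \<open>15 (1 + ln n)\<close> is
  \<open>2\<close> to the power \<open>o(sqrt (log 2 n))\<close>, so it can be moved into the error terms
  \<open>\<eta>1\<close> and \<open>\<eta>2\<close>. What remains is \<open>1 / (3 \<omega> sqrt (log 2 n))\<close>, which is below both required
  expressions once \<open>\<omega> \<ge> 2\<close> and \<open>log 2 n \<ge> 1\<close>; in the second part \<open>\<theta> = 0\<close> works.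
\<close>

section \<open>Covering a set by translates under a transitive family\<close>

text \<open>
  Double counting over \<open>\<Gamma>\<close>: by transitivity and closure under composition, a random member of \<open>\<Gamma>\<close> maps a fixed
  vertex to each vertex with the same probability, so the expected size of \<open>U \<inter> \<phi> ` A\<close> is
  \<open>|A| |U| / |V|\<close>, and some \<open>\<phi>\<close> attains at least the expectation.
\<close>

lemma translate_meeting_average:
  fixes \<Gamma> :: "('a \<Rightarrow> 'a) set"
  assumes fin: "finite V" "finite \<Gamma>"
    and perm: "\<And>\<phi>. \<phi> \<in> \<Gamma> \<Longrightarrow> \<phi> permutes V"
    and comp: "\<And>\<phi> \<psi>. \<phi> \<in> \<Gamma> \<Longrightarrow> \<psi> \<in> \<Gamma> \<Longrightarrow> \<psi> \<circ> \<phi> \<in> \<Gamma>"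
    and trans: "\<And>x y. x \<in> V \<Longrightarrow> y \<in> V \<Longrightarrow> \<exists>\<phi>\<in>\<Gamma>. \<phi> x = y"
    and A: "A \<subseteq> V" "A \<noteq> {}" and U: "U \<subseteq> V"
  shows "\<exists>\<phi>\<in>\<Gamma>. card A * card U \<le> card V * card (U \<inter> \<phi> ` A)"
proof -
  define c where "c a v = card {\<phi>\<in>\<Gamma>. \<phi> a = v}" for a v
  have le: "c a v \<le> c a w" if "a \<in> V" "v \<in> V" "w \<in> V" for a v w
  proof -
    \<comment> \<open>Composition with an element that sends \<open>v\<close> to \<open>w\<close> injects one fibre into the other.\<close>
    from trans[OF that(2,3)] obtain \<psi> where \<psi>: "\<psi> \<in> \<Gamma>" "\<psi> v = w" by blast
    have "inj_on ((\<circ>) \<psi>) {\<phi>\<in>\<Gamma>. \<phi> a = v}"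
      using fun.inj_map[OF permutes_inj[OF perm[OF \<psi>(1)]]] by (rule inj_on_subset) simp
    moreover have "(\<circ>) \<psi> ` {\<phi>\<in>\<Gamma>. \<phi> a = v} \<subseteq> {\<phi>\<in>\<Gamma>. \<phi> a = w}"
      using \<psi> comp by auto
    ultimately show ?thesis
      unfolding c_def using fin by (intro card_inj_on_le) auto
  qed
  have c: "card V * c a v = card \<Gamma>" if "a \<in> V" "v \<in> V" for a v
  proof -
    have "card \<Gamma> = card (\<Union>w\<in>V. {\<phi>\<in>\<Gamma>. \<phi> a = w})"
      using permutes_in_image[OF perm] that by (intro arg_cong[of _ _ card]) auto
    also have "\<dots> = (\<Sum>w\<in>V. c a w)"
      unfolding c_def using fin by (intro card_UN_disjoint) auto
    also have "\<dots> = (\<Sum>w\<in>V. c a v)"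
      using le that by (intro sum.cong refl antisym) auto
    finally show ?thesis by simp
  qed
  have finA: "finite A" and finU: "finite U"
    using A U fin finite_subset by auto
  have single: "card (U \<inter> \<phi> ` A) = (\<Sum>a\<in>A. \<Sum>u\<in>U. of_bool (\<phi> a = u))" if "\<phi> \<in> \<Gamma>" for \<phi>
  proof -
    have inj: "inj_on \<phi> A'" for A' using permutes_inj[OF perm[OF that]] by (rule inj_on_subset) simp
    have "U \<inter> \<phi> ` A = \<phi> ` {a\<in>A. \<phi> a \<in> U}" by auto
    hence "card (U \<inter> \<phi> ` A) = card {a\<in>A. \<phi> a \<in> U}"
      by (simp add: card_image[OF inj])
    also have "\<dots> = (\<Sum>a\<in>A. of_bool (\<phi> a \<in> U))"
      using finA by (simp add: Int_def)
    also have "\<dots> = (\<Sum>a\<in>A. \<Sum>u\<in>U. of_bool (\<phi> a = u))"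
      using finU by (intro sum.cong refl) (auto simp: of_bool_def)
    finally show ?thesis .
  qed
  have "card V * (\<Sum>\<phi>\<in>\<Gamma>. card (U \<inter> \<phi> ` A))
      = card V * (\<Sum>a\<in>A. \<Sum>u\<in>U. \<Sum>\<phi>\<in>\<Gamma>. of_bool (\<phi> a = u))"
    using single by (simp add: sum.swap[of _ _ \<Gamma>])
  also have "\<dots> = (\<Sum>a\<in>A. \<Sum>u\<in>U. card V * c a u)"
    using fin by (simp add: c_def sum_distrib_left Int_def)
  also have "\<dots> = (\<Sum>a\<in>A. \<Sum>u\<in>U. card \<Gamma>)"
    using c A U by (intro sum.cong refl) auto
  also have "\<dots> = (\<Sum>\<phi>\<in>\<Gamma>. card A * card U)"
    by simp
  finally have eq: "(\<Sum>\<phi>\<in>\<Gamma>. card V * card (U \<inter> \<phi> ` A)) = (\<Sum>\<phi>\<in>\<Gamma>. card A * card U)"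
    by (simp add: sum_distrib_left)
  have "\<Gamma> \<noteq> {}" using A trans by blast
  show ?thesis
  proof (rule ccontr)
    assume "\<not> ?thesis"
    hence "(\<Sum>\<phi>\<in>\<Gamma>. card V * card (U \<inter> \<phi> ` A)) < (\<Sum>\<phi>\<in>\<Gamma>. card A * card U)"
      using fin \<open>\<Gamma> \<noteq> {}\<close> by (intro sum_strict_mono) (auto simp: not_le)
    thus False using eq by simp
  qed
qed

text \<open>
  Greedy covering: each new translate is one that catches an average share of what is still
  uncovered. After \<open>k\<close> steps at most \<open>n (1 - s / n) ^ k \<le> n * exp (- k s / n)\<close> points are left, which is
  less than one point for \<open>k > n ln n / s\<close>.
\<close>

lemma cover_by_translates:
  fixes \<Gamma> :: "('a \<Rightarrow> 'a) set"
  assumes fin: "finite V" "finite \<Gamma>"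
    and perm: "\<And>\<phi>. \<phi> \<in> \<Gamma> \<Longrightarrow> \<phi> permutes V"
    and comp: "\<And>\<phi> \<psi>. \<phi> \<in> \<Gamma> \<Longrightarrow> \<psi> \<in> \<Gamma> \<Longrightarrow> \<psi> \<circ> \<phi> \<in> \<Gamma>"
    and trans: "\<And>x y. x \<in> V \<Longrightarrow> y \<in> V \<Longrightarrow> \<exists>\<phi>\<in>\<Gamma>. \<phi> x = y"
    and A: "A \<subseteq> V" "A \<noteq> {}"
  shows "\<exists>K \<Phi>. (\<forall>k<K. \<Phi> k \<in> \<Gamma>) \<and> V \<subseteq> (\<Union>k<K. \<Phi> k ` A) \<and>
           real K * card A \<le> card V * (1 + ln (card V))"
proof -
  define n s where "n = real (card V)" and "s = real (card A)"
  have s: "0 < s" "s \<le> n"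
    using A fin finite_subset[OF A(1) fin(1)] card_mono[OF fin(1) A(1)]
    by (auto simp: n_def s_def card_gt_0_iff)
  have greedy: "\<exists>\<Phi>. (\<forall>i<k. \<Phi> i \<in> \<Gamma>) \<and> real (card (V - (\<Union>i<k. \<Phi> i ` A))) \<le> n * (1 - s / n) ^ k" for k
  proof (induction k)
    case 0
    thus ?case by (simp add: n_def)
  next
    case (Suc k)
    then obtain \<Phi> where \<Phi>: "\<And>i. i < k \<Longrightarrow> \<Phi> i \<in> \<Gamma>"
      and IH: "real (card (V - (\<Union>i<k. \<Phi> i ` A))) \<le> n * (1 - s / n) ^ k" by blast
    define U where "U = V - (\<Union>i<k. \<Phi> i ` A)"
    have "\<exists>\<phi>\<in>\<Gamma>. card A * card U \<le> card V * card (U \<inter> \<phi> ` A)"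
      by (rule translate_meeting_average[OF fin perm comp trans A]) (auto simp: U_def)
    then obtain \<phi> where \<phi>: "\<phi> \<in> \<Gamma>" "card A * card U \<le> card V * card (U \<inter> \<phi> ` A)" by blast
    let ?\<Phi> = "\<Phi>(k := \<phi>)"
    have "(\<Union>i<k. ?\<Phi> i ` A) = (\<Union>i<k. \<Phi> i ` A)"
      by (intro SUP_cong) auto
    hence "V - (\<Union>i<Suc k. ?\<Phi> i ` A) = U - U \<inter> \<phi> ` A"
      unfolding lessThan_Suc UN_insert by (auto simp: U_def)
    moreover have "finite U" using fin by (simp add: U_def)
    ultimately have "real (card (V - (\<Union>i<Suc k. ?\<Phi> i ` A))) = real (card U) - real (card (U \<inter> \<phi> ` A))"
      by (simp add: card_Diff_subset of_nat_diff card_mono)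
    also have "\<dots> \<le> card U - s * card U / n"
    proof -
      have "s * real (card U) \<le> n * real (card (U \<inter> \<phi> ` A))"
        using \<phi>(2) unfolding n_def s_def of_nat_mult[symmetric] of_nat_le_iff .
      thus ?thesis using s by (simp add: field_simps)
    qed
    also have "\<dots> = card U * (1 - s / n)" by (simp add: algebra_simps)
    also have "\<dots> \<le> (n * (1 - s / n) ^ k) * (1 - s / n)"
      using IH s by (intro mult_right_mono) (auto simp: U_def field_simps)
    finally have "real (card (V - (\<Union>i<Suc k. ?\<Phi> i ` A))) \<le> n * (1 - s / n) ^ Suc k"
      by (simp add: algebra_simps)
    moreover have "\<forall>i<Suc k. ?\<Phi> i \<in> \<Gamma>" using \<Phi> \<phi> by (auto simp: less_Suc_eq)
    ultimately show ?case by blast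
  qed
  define K where "K = nat \<lfloor>n * ln n / s\<rfloor> + 1"
  have "card V > 0" using s by (simp add: n_def)
  hence n1: "n \<ge> 1" by (simp add: n_def)
  hence q: "n * ln n / s \<ge> 0" using s by simp
  have K: "n * ln n / s < K" "K \<le> n * ln n / s + 1"
    using q unfolding K_def by linarith+
  from greedy[of K] obtain \<Phi> where \<Phi>: "\<forall>i<K. \<Phi> i \<in> \<Gamma>"
    and le: "real (card (V - (\<Union>i<K. \<Phi> i ` A))) \<le> n * (1 - s / n) ^ K" by blast
  have "(1 - s / n) ^ K \<le> exp (- (s / n)) ^ K"
    using exp_ge_add_one_self[of "- (s / n)"] s by (intro power_mono) (auto simp: field_simps)
  also have "\<dots> = exp (- (K * s / n))"
    by (simp add: exp_of_nat_mult[symmetric])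
  also have "\<dots> < exp (- ln n)"
    using K(1) s n1 by (simp add: field_simps)
  also have "\<dots> = 1 / n" using n1 by (simp add: exp_minus field_simps)
  finally have "n * (1 - s / n) ^ K < 1" using n1 by (simp add: field_simps)
  with le have "card (V - (\<Union>i<K. \<Phi> i ` A)) = 0" by linarith
  hence "V \<subseteq> (\<Union>k<K. \<Phi> k ` A)" using fin by auto
  moreover have "real K * s \<le> n * (1 + ln n)"
  proof -
    have "real K * s \<le> (n * ln n / s + 1) * s" using K(2) s by (intro mult_right_mono) auto
    also have "\<dots> = n * ln n + s" using s by (simp add: field_simps)
    finally show ?thesis using s by (simp add: algebra_simps)
  qed
  ultimately show ?thesis using \<Phi> unfolding n_def s_def by blast
qed

section \<open>Five cops per shadowed path\<close>

text \<open>
  To win, it is enough that the cops move legally up to round \<open>T\<close> and that after the robber's move in round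
  \<open>T\<close> some cop is within one step of the robber. Every such cop steps onto the robber in the next round.
  The definition of a strategy also asks for legal moves after the capture; all cops then
  stand still for good.
\<close>

lemma cops_winI:
  assumes init: "\<And>i. i < k \<Longrightarrow> pos [] i \<in> verts G"
    and legal: "\<And>r t i. robber_play G r \<Longrightarrow> t < T \<Longrightarrow> i < k \<Longrightarrow>
           legal_move G (pos (map r [0..<t]) i) (pos (map r [0..<Suc t]) i)"
    and dom: "\<And>r. robber_play G r \<Longrightarrow> \<exists>i<k. legal_move G (pos (map r [0..<T]) i) (r T)"
  shows "cops_win G k"
proof -
  define \<sigma> where "\<sigma> h i = (if length h \<le> T then pos h i
      else let p = pos (take T h) i in if legal_move G p (h ! T) then h ! T else p)" for h i
  have late: "\<sigma> (map r [0..<t]) i = (let p = pos (map r [0..<T]) i in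
      if legal_move G p (r T) then r T else p)" if "T < t" for r t i
  proof -
    have nth: "map r [0..<t] ! T = r T" using that by simp
    show ?thesis using that by (auto simp: \<sigma>_def take_map nth Let_def)
  qed
  have early: "\<sigma> (map r [0..<t]) i = pos (map r [0..<t]) i" if "t \<le> T" for r t i
    using that by (simp add: \<sigma>_def)
  have verts: "pos (map r [0..<t]) i \<in> verts G" if "robber_play G r" "t \<le> T" "i < k" for r t i
  proof (cases t)
    case 0
    thus ?thesis using init that by simp
  next
    case (Suc t')
    thus ?thesis using legal[OF that(1), of t' i] that by (simp add: legal_move_def)
  qed
  have "legal_move G (\<sigma> (map r [0..<t]) i) (\<sigma> (map r [0..<Suc t]) i)"
    if r: "robber_play G r" and i: "i < k" for r t i
  proof -
    consider "t < T" | "t = T" | "T < t" by linarith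
    thus ?thesis
    proof cases
      case 1
      thus ?thesis using legal[OF r 1 i] by (simp add: early del: upt_Suc)
    next
      case 2
      thus ?thesis using verts[OF r _ i, of T]
        by (auto simp: early late Let_def legal_move_def simp del: upt_Suc)
    next
      case 3
      thus ?thesis using verts[OF r _ i, of T]
        by (auto simp: late Let_def legal_move_def simp del: upt_Suc)
    qed
  qed
  moreover have "\<sigma> [] i \<in> verts G" if "i < k" for i
    using init that by (simp add: \<sigma>_def)
  ultimately have "cop_strategy G k \<sigma>"
    unfolding cop_strategy_def by blast
  moreover have "captured k \<sigma> r" if r: "robber_play G r" for r
  proof -
    from dom[OF r] obtain i where "i < k" "legal_move G (pos (map r [0..<T]) i) (r T)" by blast
    hence "\<sigma> (map r [0..<Suc T]) i = r T" by (simp add: late del: upt_Suc)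
    thus ?thesis using \<open>i < k\<close> unfolding captured_def by blast
  qed
  ultimately show ?thesis unfolding cops_win_def by blast
qed

text \<open>
  The paths \<open>Q k\<close> and the potentials \<open>f k\<close> abstract from the images of a shortest path and the
  distances from their starting points. The potentials need only two properties: a potential changes by at most one along an
  edge, and every vertex is a neighbour of some \<open>Q k j\<close> whose index \<open>j\<close> is close to the potential.
\<close>

lemma cops_win_shadows:
  fixes Q :: "nat \<Rightarrow> nat \<Rightarrow> 'a" and f :: "nat \<Rightarrow> 'a \<Rightarrow> nat"
  assumes G: "pair_graph G" and d: "0 < d"
    and Q: "\<And>k i. k < K \<Longrightarrow> i < d \<Longrightarrow> (Q k i, Q k (Suc i)) \<in> parcs G"
    and f: "\<And>k x y. k < K \<Longrightarrow> (x, y) \<in> parcs G \<Longrightarrow> f k x \<le> Suc (f k y)"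
    and cover: "\<And>x. x \<in> pverts G \<Longrightarrow>
          \<exists>k<K. \<exists>j\<le>d. (Q k j, x) \<in> parcs G \<and> f k x \<le> Suc j \<and> j \<le> Suc (f k x)"
  shows "cops_win (with_proj G) (5 * K)"
proof -
  interpret pair_graph G by (rule G)
  have sym: "(y, x) \<in> parcs G" if "(x, y) \<in> parcs G" for x y
    using arcs_symmetric[OF that] .
  have Qv: "Q k i \<in> pverts G" if "k < K" "i \<le> d" for k i
  proof (cases "i < d")
    case True
    thus ?thesis using Q[OF that(1) True] in_arcsD1 by blast
  next
    case False
    thus ?thesis using Q[OF that(1), of "d - 1"] that d in_arcsD2 by force
  qed
  have step: "legal_move (with_proj G) (Q k i) (Q k j)"
    if "k < K" "i \<le> d" "j \<le> d" "i \<le> Suc j" "j \<le> Suc i" for k i j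
  proof -
    have "i = j \<or> j = Suc i \<or> i = Suc j" using that(4,5) by arith
    thus ?thesis
      using that Q[of k i] Q[of k j] Qv[of k i] Qv[of k j] sym
      by (auto simp: legal_move_def)
  qed
  \<comment> \<open>Cop \<open>i\<close> serves path \<open>i div 5\<close>. It aims at the index \<open>f + (i mod 5) - 2\<close>, clamped to the
    path; natural subtraction clamps at \<open>0\<close>.\<close>
  define target where "target i x = min d (f (i div 5) x + i mod 5 - 2)" for i x
  \<comment> \<open>All cops start at index \<open>0\<close>. Since the target lies in \<open>{0..d}\<close> and moves by at most one, the
    minimum of the round number and the target is a legal walk that coincides with the target from round \<open>d\<close> on.\<close>
  define pos where "pos h i = Q (i div 5) (min (length h) (target i (last h)))" for h i
  have clamp: "min d (a + e - 2) \<le> Suc (min d (b + e - 2))" if "a \<le> Suc b" for a b e :: nat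
    using that by arith
  have lip: "f k (r t) \<le> Suc (f k (r (Suc t))) \<and> f k (r (Suc t)) \<le> Suc (f k (r t))"
    if "robber_play (with_proj G) r" "k < K" for r t k
  proof -
    have "r (Suc t) = r t \<or> (r t, r (Suc t)) \<in> parcs G"
      using that by (auto simp: robber_play_def legal_move_def)
    thus ?thesis using f[OF that(2)] sym by auto
  qed
  show ?thesis
  proof (rule cops_winI[where T = d and pos = pos])
    fix i assume "i < 5 * K"
    hence "i div 5 < K" by (simp add: less_mult_imp_div_less mult.commute)
    thus "pos [] i \<in> verts (with_proj G)" by (simp add: pos_def Qv)
  next
    fix r t i assume r: "robber_play (with_proj G) r" and t: "t < d" and "i < 5 * K"
    hence k: "i div 5 < K" by (simp add: less_mult_imp_div_less mult.commute)
    have *: "target i (r t') \<le> d" for t' by (simp add: target_def)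
    show "legal_move (with_proj G) (pos (map r [0..<t]) i) (pos (map r [0..<Suc t]) i)"
    proof (cases t)
      case 0
      show ?thesis unfolding pos_def
        by (rule step[OF k]) (use 0 * in \<open>auto simp: target_def\<close>)
    next
      case (Suc t')
      have "target i (r t') \<le> Suc (target i (r t)) \<and> target i (r t) \<le> Suc (target i (r t'))"
        using lip[OF r k, of t'] Suc unfolding target_def by (blast intro: clamp)
      thus ?thesis unfolding pos_def
        by (intro step[OF k]) (use Suc *[of t] *[of t'] t in \<open>auto simp: last_map\<close>)
    qed
  next
    fix r assume r: "robber_play (with_proj G) r"
    have rd: "r d \<in> pverts G"
      using d r by (cases d) (auto simp: robber_play_def legal_move_def)
    then obtain k j where k: "k < K" "j \<le> d" "(Q k j, r d) \<in> parcs G"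
      "f k (r d) \<le> Suc j" "j \<le> Suc (f k (r d))" using cover by blast
    \<comment> \<open>At this moment the cops still shadow the robber position of round \<open>d - 1\<close>, hence an
      offset of up to two.\<close>
    define e where "e = j + 2 - f k (r (d - 1))"
    have "f k (r (d-1)) \<le> j + 2 \<and> j \<le> f k (r (d-1)) + 2"
      using lip[OF r k(1), of "d - 1"] d k by simp
    hence e: "e < 5" "f k (r (d-1)) + e - 2 = j" unfolding e_def by auto
    let ?i = "5 * k + e"
    have "?i < 5 * K" using e(1) k(1) by simp
    moreover have "pos (map r [0..<d]) ?i = Q k j"
      using e k d by (simp add: pos_def target_def last_map)
    hence "legal_move (with_proj G) (pos (map r [0..<d]) ?i) (r d)"
      using k rd Qv by (auto simp: legal_move_def)
    ultimately show "\<exists>i<5 * K. legal_move (with_proj G) (pos (map r [0..<d]) i) (r d)" by blast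
  qed
qed

section \<open>Shortest paths and the diameter\<close>

definition hop_dist :: "('a \<times> 'a) set \<Rightarrow> 'a \<Rightarrow> 'a \<Rightarrow> nat" where
  "hop_dist E u v = (LEAST k. (u, v) \<in> E ^^ k)"

lemma hop_dist_relpow: "(u, v) \<in> E\<^sup>* \<Longrightarrow> (u, v) \<in> E ^^ hop_dist E u v"
  unfolding hop_dist_def by (rule LeastI_ex) (rule rtrancl_imp_relpow)

lemma hop_dist_le: "(u, v) \<in> E ^^ k \<Longrightarrow> hop_dist E u v \<le> k"
  unfolding hop_dist_def by (rule Least_le)

lemma hop_dist_triangle:
  assumes "(u, x) \<in> E\<^sup>*" "(x, y) \<in> E ^^ k"
  shows "hop_dist E u y \<le> hop_dist E u x + k"
  using hop_dist_relpow[OF assms(1)] assms(2) by (intro hop_dist_le) (auto simp: relpow_add)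

lemma hop_dist_edge:
  assumes "(u, x) \<in> E\<^sup>*" "(x, y) \<in> E"
  shows "hop_dist E u y \<le> Suc (hop_dist E u x)"
  using hop_dist_triangle[of u x E y 1] assms by simp

text \<open>
  On a walk of length \<open>hop_dist E u v\<close>, a vertex closer to \<open>u\<close> than its index would give a
  shorter walk to \<open>v\<close>.
\<close>

lemma geodesic_exists:
  assumes "(u, v) \<in> E\<^sup>*"
  shows "\<exists>P. (\<forall>i<hop_dist E u v. (P i, P (Suc i)) \<in> E) \<and>
             (\<forall>j\<le>hop_dist E u v. hop_dist E u (P j) = j \<and> (u, P j) \<in> E\<^sup>*)"
proof -
  define d where "d = hop_dist E u v"
  from hop_dist_relpow[OF assms] obtain P where
    P: "P 0 = u" "P d = v" "\<And>i. i < d \<Longrightarrow> (P i, P (Suc i)) \<in> E"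
    unfolding relpow_fun_conv d_def by blast
  have seg: "(P i, P j) \<in> E ^^ (j - i)" if "i \<le> j" "j \<le> d" for i j
    unfolding relpow_fun_conv using that P by (intro exI[of _ "\<lambda>k. P (i + k)"]) auto
  have "hop_dist E u (P j) = j \<and> (u, P j) \<in> E\<^sup>*" if "j \<le> d" for j
  proof -
    have pre: "(u, P j) \<in> E ^^ j" using seg[of 0 j] that P by simp
    hence reach: "(u, P j) \<in> E\<^sup>*" by (rule relpow_imp_rtrancl)
    have "(P j, v) \<in> E ^^ (d - j)" using seg[of j d] that P by simp
    hence "d \<le> hop_dist E u (P j) + (d - j)"
      using hop_dist_triangle[OF reach] by (simp add: d_def)
    with hop_dist_le[OF pre] reach that show ?thesis by simp
  qed
  with P(3) show ?thesis unfolding d_def by blast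
qed

text \<open>
  A neighbour of \<open>P j\<close> is at distance \<open>j - 1\<close>, \<open>j\<close> or \<open>j + 1\<close> from \<open>u\<close>, so the neighbourhoods of
  \<open>P 0\<close>, \<open>P 3\<close>, \<open>P 6\<close>, \<open>\<dots>\<close> are disjoint.
\<close>

lemma card_nbhd_geodesic:
  assumes fin: "finite E" and sym: "sym E"
    and P: "\<And>j. j \<le> d \<Longrightarrow> hop_dist E u (P j) = j \<and> (u, P j) \<in> E\<^sup>*"
    and deg: "\<And>j. j \<le> d \<Longrightarrow> card {x. (P j, x) \<in> E} = m"
  shows "m * d \<le> 3 * card {x. \<exists>j\<le>d. (P j, x) \<in> E}"
proof -
  let ?N = "\<lambda>j. {x. (P j, x) \<in> E}"
  have fN: "finite (?N j)" for j
    using fin by (rule finite_surj[of _ _ snd]) force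
  have near: "hop_dist E u x \<le> Suc j \<and> j \<le> Suc (hop_dist E u x)" if "(P j, x) \<in> E" "j \<le> d" for j x
  proof -
    have "(u, x) \<in> E\<^sup>*" using P[OF that(2)] that(1) by (meson rtrancl.rtrancl_into_rtrancl)
    thus ?thesis
      using hop_dist_edge[of u "P j" E x] hop_dist_edge[of u x E "P j"] P[OF that(2)] that symD[OF sym]
      by auto
  qed
  have third: "3 * i \<le> d" if "i \<le> d div 3" for i using that by simp
  have "m * (d div 3 + 1) = (\<Sum>i\<le>d div 3. card (?N (3 * i)))"
    using deg third by simp
  also have "\<dots> = card (\<Union>i\<le>d div 3. ?N (3 * i))"
  proof (rule card_UN_disjoint[symmetric], safe)
    fix i j x assume ij: "i \<le> d div 3" "j \<le> d div 3" "i \<noteq> j"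
      and x: "(P (3 * i), x) \<in> E" "(P (3 * j), x) \<in> E"
    have "i = j"
      using near[OF x(1) third[OF ij(1)]] near[OF x(2) third[OF ij(2)]] by linarith
    thus "x \<in> {}" using ij by simp
  qed (use fN in auto)
  also have "\<dots> \<le> card {x. \<exists>j\<le>d. (P j, x) \<in> E}"
  proof (rule card_mono)
    have "{x. \<exists>j\<le>d. (P j, x) \<in> E} = (\<Union>j\<le>d. ?N j)" by auto
    thus "finite {x. \<exists>j\<le>d. (P j, x) \<in> E}" using fN by simp
  qed (use third in blast)
  finally have "3 * (m * (d div 3 + 1)) \<le> 3 * card {x. \<exists>j\<le>d. (P j, x) \<in> E}" by simp
  moreover have "d \<le> 3 * (d div 3 + 1)" by simp
  hence "m * d \<le> 3 * (m * (d div 3 + 1))"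
    using mult_le_mono2[of d "3 * (d div 3 + 1)" m] by (simp add: algebra_simps)
  ultimately show ?thesis by linarith
qed

lemma connected_rtrancl:
  assumes "pair_graph G" "Digraph_Component.connected (with_proj G)" "x \<in> pverts G" "y \<in> pverts G"
  shows "(x, y) \<in> (parcs G)\<^sup>*"
proof -
  interpret pair_graph G by fact
  have "x \<rightarrow>\<^sup>*\<^bsub>with_proj G\<^esub> y"
    using assms reachable_mk_symmetric_eq[OF pair_sym_arcs]
    by (simp add: connected_def strongly_connected_def)
  thus ?thesis unfolding reachable_def by (simp add: rtrancl_on_rtranclI)
qed

lemma (in pair_graph) relpow_imp_awalk:
  "(u, v) \<in> parcs G ^^ k \<Longrightarrow> u \<in> pverts G \<Longrightarrow> \<exists>p. awalk u p v \<and> length p = k"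
proof (induction k arbitrary: u)
  case 0
  thus ?case by (intro exI[of _ "[]"]) (simp add: awalk_Nil_iff)
next
  case (Suc k)
  from relpow_Suc_E2[OF Suc.prems(1)] obtain w where w: "(u, w) \<in> parcs G" "(w, v) \<in> parcs G ^^ k" .
  moreover obtain p where "awalk w p v" "length p = k"
    using Suc.IH[OF w(2)] in_arcsD2[OF w(1)] by blast
  ultimately show ?case by (intro exI[of _ "(u, w) # p"]) (simp add: awalk_Cons_iff)
qed

lemma diam_le_hop_dist:
  assumes G: "pair_graph G" and conn: "Digraph_Component.connected (with_proj G)"
  shows "\<exists>u\<in>pverts G. \<exists>v\<in>pverts G. diam (with_proj G) \<le> ereal (hop_dist (parcs G) u v)"
proof -
  interpret pair_graph G by (rule G)
  let ?h = "\<lambda>(u, v). hop_dist (parcs G) u v"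
  let ?VV = "pverts G \<times> pverts G"
  have ne: "pverts G \<noteq> {}" using conn by (auto simp: connected_def strongly_connected_def)
  have fin: "finite (?h ` ?VV)" using pair_finite_verts by simp
  have "Max (?h ` ?VV) \<in> ?h ` ?VV" using fin ne by (intro Max_in) auto
  then obtain u v where uv: "u \<in> pverts G" "v \<in> pverts G" "Max (?h ` ?VV) = hop_dist (parcs G) u v"
    by auto
  have "\<mu> (\<lambda>_. 1) a b \<le> ereal (hop_dist (parcs G) u v)" if ab: "a \<in> pverts G" "b \<in> pverts G" for a b
  proof -
    from relpow_imp_awalk[OF hop_dist_relpow[OF connected_rtrancl[OF G conn ab]] ab(1)]
    obtain p where p: "awalk a p b" "length p = hop_dist (parcs G) a b" by blast
    have "awalk_cost (\<lambda>_. 1) q = length q" for q :: "('a \<times> 'a) list" by (induction q) auto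
    hence "\<mu> (\<lambda>_. 1) a b \<le> ereal (hop_dist (parcs G) a b)"
      using min_cost_le_walk_cost[OF p(1), of "\<lambda>_. 1"] p(2) by simp
    also have "hop_dist (parcs G) a b \<le> Max (?h ` ?VV)" using ab fin by (intro Max_ge) auto
    finally show ?thesis unfolding uv(3) by simp
  qed
  hence "diam (with_proj G) \<le> ereal (hop_dist (parcs G) u v)"
    unfolding diam_def by (intro SUP_least) simp
  thus ?thesis using uv by blast
qed

section \<open>Vertex-transitive graphs\<close>

text \<open>
  Isomorphism records carry arbitrary values off the graph. As permutations that fix every
  non-vertex, the automorphisms of a finite graph form a finite set closed under composition,
  which the counting argument requires.
\<close>

definition edge_perms :: "'a pair_pre_digraph \<Rightarrow> ('a \<Rightarrow> 'a) set" where
  "edge_perms G = {\<phi>. \<phi> permutes pverts G \<and> (\<forall>x y. (\<phi> x, \<phi> y) \<in> parcs G \<longleftrightarrow> (x, y) \<in> parcs G)}"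

lemma edge_perms_transitive:
  assumes G: "pair_graph G" and vt: "vertex_transitive (with_proj G)"
    and x: "x \<in> pverts G" and y: "y \<in> pverts G"
  shows "\<exists>\<phi>\<in>edge_perms G. \<phi> x = y"
proof -
  interpret pair_graph G by (rule G)
  from vt x y obtain h where h: "automorphism (with_proj G) h" "iso_verts h x = y"
    unfolding vertex_transitive_def by auto
  let ?g = "iso_verts h"
  have iso: "digraph_isomorphism h" and app: "app_iso h (with_proj G) = with_proj G"
    using h(1) by (auto simp: automorphism_def)
  have img: "?g ` pverts G = pverts G" "iso_arcs h ` parcs G = parcs G"
    "iso_tail h = fst" "iso_head h = snd"
    using app by (simp_all add: app_iso_def with_proj_def)
  have inj: "inj_on ?g (pverts G)" using digraph_isomorphism_inj_on_verts[OF iso] .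
  have arc: "iso_arcs h (a, b) = (?g a, ?g b)" if "(a, b) \<in> parcs G" for a b
    using iso_verts_tail[OF iso that] iso_verts_head[OF iso that] img by (simp add: prod_eq_iff)
  have edge: "(?g a, ?g b) \<in> parcs G \<longleftrightarrow> (a, b) \<in> parcs G" if "a \<in> pverts G" "b \<in> pverts G" for a b
  proof
    assume "(a, b) \<in> parcs G"
    thus "(?g a, ?g b) \<in> parcs G" using arc img(2) by (metis imageI)
  next
    assume "(?g a, ?g b) \<in> parcs G"
    then obtain a' b' where ab': "(a', b') \<in> parcs G" "(?g a, ?g b) = iso_arcs h (a', b')"
      using img(2) by (metis (no_types, lifting) imageE surj_pair)
    hence "?g a = ?g a'" "?g b = ?g b'" using arc by auto
    thus "(a, b) \<in> parcs G"
      using inj_onD[OF inj] that in_arcsD1[OF ab'(1)] in_arcsD2[OF ab'(1)] ab'(1) by metis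
  qed
  define \<phi> where "\<phi> z = (if z \<in> pverts G then ?g z else z)" for z
  have "bij_betw \<phi> (pverts G) (pverts G)"
    using inj img(1) by (subst bij_betw_cong[of _ _ ?g]) (auto simp: \<phi>_def bij_betw_def)
  hence perm: "\<phi> permutes pverts G" by (rule bij_imp_permutes) (simp add: \<phi>_def)
  have "(\<phi> a, \<phi> b) \<in> parcs G \<longleftrightarrow> (a, b) \<in> parcs G" for a b
  proof (cases "a \<in> pverts G \<and> b \<in> pverts G")
    case True
    thus ?thesis using edge by (simp add: \<phi>_def)
  next
    case False
    thus ?thesis using permutes_in_image[OF perm] in_arcsD1 in_arcsD2 by blast
  qed
  thus ?thesis using perm h(2) x by (intro bexI[of _ \<phi>]) (auto simp: edge_perms_def \<phi>_def)
qed

text \<open>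
  Five cops guard each translate of the neighbourhood of a shortest path, and the covering bound
  counts the translates. The degree and the diameter enter only through the size of that
  neighbourhood, so any lower bound \<open>X\<close> on their product yields the estimate.
\<close>

theorem cop_number_vertex_transitive:
  assumes G: "G \<in> vt_graphs n m" and X: "0 < X" "ereal X \<le> ereal (real m) * diam (with_proj G)"
  shows "real (cop_number (with_proj G)) \<le> 15 * real n * (1 + ln n) / X"
proof -
  have pg: "pair_graph G" and conn: "Digraph_Component.connected (with_proj G)"
    and vt: "vertex_transitive (with_proj G)" and n: "card (pverts G) = n"
    and deg: "regular (with_proj G) m"
    using G by (auto simp: vt_graphs_def)
  interpret pair_graph G by (rule pg)
  let ?E = "parcs G" and ?V = "pverts G"
  have sym: "sym ?E" using pair_sym_arcs by (simp add: symmetric_def)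
  from diam_le_hop_dist[OF pg conn] obtain u v where
    uv: "u \<in> ?V" "v \<in> ?V" "diam (with_proj G) \<le> ereal (hop_dist ?E u v)" by blast
  define d where "d = hop_dist ?E u v"
  have "ereal X \<le> ereal m * ereal d"
    unfolding d_def by (rule order_trans[OF X(2) ereal_mult_left_mono[OF uv(3)]]) simp
  hence Xmd: "X \<le> real (m * d)" by simp
  with X(1) have "0 < m * d" by (metis of_nat_0_less_iff order_less_le_trans)
  hence d: "0 < d" by simp
  from geodesic_exists[OF connected_rtrancl[OF pg conn uv(1,2)]] obtain P where
    P: "\<And>i. i < d \<Longrightarrow> (P i, P (Suc i)) \<in> ?E"
       "\<And>j. j \<le> d \<Longrightarrow> hop_dist ?E u (P j) = j \<and> (u, P j) \<in> ?E\<^sup>*"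
    unfolding d_def by blast
  have PV: "P j \<in> ?V" if "j \<le> d" for j
    using P(1)[of j] P(1)[of "j - 1"] that d in_arcsD1 in_arcsD2 by (cases "j < d") force+
  define A where "A = {x. \<exists>j\<le>d. (P j, x) \<in> ?E}"
  have "card {x. (P j, x) \<in> ?E} = m" if "j \<le> d" for j
  proof -
    have "out_degree (with_proj G) (P j) = m" using deg PV[OF that] by (simp add: regular_def)
    moreover have "out_arcs (with_proj G) (P j) = Pair (P j) ` {x. (P j, x) \<in> ?E}"
      by (auto simp: out_arcs_def)
    ultimately show ?thesis by (simp add: out_degree_def card_image inj_on_def)
  qed
  from card_nbhd_geodesic[OF pair_finite_arcs sym P(2) this] have mdA: "m * d \<le> 3 * card A"
    unfolding A_def by blast
  have "card A \<noteq> 0" using mdA \<open>0 < m * d\<close> by linarith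
  hence "A \<noteq> {}" by force
  moreover have "A \<subseteq> ?V" using in_arcsD2 by (auto simp: A_def)
  ultimately have A: "A \<subseteq> ?V" "A \<noteq> {}" by blast+
  have perm: "\<phi> permutes ?V" "(\<phi> x, \<phi> y) \<in> ?E \<longleftrightarrow> (x, y) \<in> ?E" if "\<phi> \<in> edge_perms G" for \<phi> x y
    using that by (auto simp: edge_perms_def)
  have comp: "\<psi> \<circ> \<phi> \<in> edge_perms G" if "\<phi> \<in> edge_perms G" "\<psi> \<in> edge_perms G" for \<phi> \<psi>
    using that by (auto simp: edge_perms_def permutes_compose)
  have "finite (edge_perms G)"
    by (rule finite_subset[OF _ finite_permutations[OF pair_finite_verts]]) (auto simp: edge_perms_def)
  from cover_by_translates[OF pair_finite_verts this perm(1) comp edge_perms_transitive[OF pg vt] A]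
  obtain K \<Phi> where \<Phi>: "\<And>k. k < K \<Longrightarrow> \<Phi> k \<in> edge_perms G" "?V \<subseteq> (\<Union>k<K. \<Phi> k ` A)"
    and K: "real K * card A \<le> n * (1 + ln n)" unfolding n by blast
  have inv: "inv (\<Phi> k) (\<Phi> k x) = x" "\<Phi> k (inv (\<Phi> k) x) = x" if "k < K" for k x
    using permutes_inverses[OF perm(1)[OF \<Phi>(1)[OF that]]] by auto
  have invE: "(inv (\<Phi> k) x, inv (\<Phi> k) y) \<in> ?E \<longleftrightarrow> (x, y) \<in> ?E" if "k < K" for k x y
    using perm(2)[OF \<Phi>(1)[OF that], of "inv (\<Phi> k) x" "inv (\<Phi> k) y"] inv[OF that] by simp
  have lip: "hop_dist ?E u x \<le> Suc (hop_dist ?E u y)" if "(x, y) \<in> ?E" for x y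
    using hop_dist_edge[OF connected_rtrancl[OF pg conn uv(1) in_arcsD2[OF that]]] symD[OF sym that] .
  \<comment> \<open>The distance from the start of the \<open>k\<close>-th translated path is the distance from \<open>u\<close> after
    translating back, so it changes by at most one along an edge: \<open>\<Phi> k\<close> preserves edges both ways.\<close>
  have "cops_win (with_proj G) (5 * K)"
  proof (rule cops_win_shadows[OF pg d, where Q = "\<lambda>k i. \<Phi> k (P i)" and f = "\<lambda>k x. hop_dist ?E u (inv (\<Phi> k) x)"])
    fix x assume "x \<in> ?V"
    then obtain k a where k: "k < K" "a \<in> A" "x = \<Phi> k a" using \<Phi>(2) by auto
    then obtain j where j: "j \<le> d" "(P j, a) \<in> ?E" by (auto simp: A_def)
    have "hop_dist ?E u a \<le> Suc j" "j \<le> Suc (hop_dist ?E u a)"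
      using lip[OF j(2)] lip[OF symD[OF sym j(2)]] P(2)[OF j(1)] by auto
    thus "\<exists>k<K. \<exists>j\<le>d. (\<Phi> k (P j), x) \<in> ?E \<and> hop_dist ?E u (inv (\<Phi> k) x) \<le> Suc j \<and>
        j \<le> Suc (hop_dist ?E u (inv (\<Phi> k) x))"
      using k j inv perm(2)[OF \<Phi>(1)] by (intro exI[of _ k] exI[of _ j] conjI) auto
  qed (use perm(2)[OF \<Phi>(1)] P(1) lip invE in auto)
  hence "cop_number (with_proj G) \<le> 5 * K" unfolding cop_number_def by (rule Least_le)
  hence "real (cop_number (with_proj G)) * X \<le> real (5 * K) * real (m * d)"
    using Xmd X(1) by (intro mult_mono) (simp_all only: of_nat_le_iff of_nat_0_le_iff)
  also have "\<dots> \<le> real (5 * K) * real (3 * card A)"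
    using mdA by (intro mult_left_mono) (simp_all only: of_nat_le_iff of_nat_0_le_iff)
  also have "\<dots> \<le> 15 * (n * (1 + ln n))" using K by simp
  finally show ?thesis using X(1) by (simp add: field_simps)
qed

section \<open>Asymptotics\<close>

text \<open>
  A logarithmic factor in \<open>n\<close> is \<open>2\<close> to the power \<open>o(sqrt (log 2 n))\<close>, so it costs only an additive null
  sequence in the exponent.
\<close>

lemma log_factor_subexponential:
  "(\<lambda>n::nat. log 2 (15 * (1 + ln (real n))) / sqrt (log 2 (real n))) \<longlonglongrightarrow> 0"
  by real_asymp

lemma smallo_mult_null:
  fixes f g :: "nat \<Rightarrow> real"
  assumes "g \<longlonglongrightarrow> 0"
  shows "(\<lambda>n. f n * g n) \<in> o(f)"
proof -
  have "g \<in> o(\<lambda>_. 1)" using assms by (intro smalloI_tendsto) simp_all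
  from landau_o.small.mult_left[OF this, of f] show ?thesis by simp
qed

theorem corollary19:
  fixes \<omega> :: "nat \<Rightarrow> int" and \<eta> :: "nat \<Rightarrow> real"
  assumes "mono \<omega>"
    and "filterlim \<omega> at_top sequentially"
    and "\<eta> \<longlonglongrightarrow> 0"
  shows
    "((\<lambda>n. real_of_int (\<omega> n)) \<in> \<Omega>[sequentially](\<lambda>n. 2 powr sqrt (log 2 (real n))) \<longrightarrow>
       (\<exists>\<eta>1 :: nat \<Rightarrow> real. \<eta>1 \<longlonglongrightarrow> 0 \<and>
         (\<forall>\<^sub>F n in sequentially. \<forall>m. \<forall>G :: 'a pair_pre_digraph. G \<in> vt_graphs n m \<and>
            ereal (real m) * diam (with_proj G) \<ge>
              ereal (3 * real_of_int (\<omega> n) * 2 powr ((1 - \<eta> n) * sqrt (log 2 (real n)))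
                * sqrt (log 2 (real n))) \<longrightarrow>
            real (cop_number (with_proj G)) \<le>
              real n / 2 powr ((1 - \<eta>1 n) * sqrt (log 2 (real n)))
                * (3 * log 2 (real_of_int (\<omega> n)) / (3 * real_of_int (\<omega> n) * sqrt (log 2 (real n))))) \<and>
         (\<lambda>n. real n / 2 powr ((1 - \<eta>1 n) * sqrt (log 2 (real n)))
                * (3 * log 2 (real_of_int (\<omega> n)) / (3 * real_of_int (\<omega> n) * sqrt (log 2 (real n)))))
           \<in> o[sequentially](\<lambda>n. real n / 2 powr ((1 - \<eta>1 n) * sqrt (log 2 (real n)))))) \<and>
     ((\<lambda>n. real_of_int (\<omega> n)) \<in> o[sequentially](\<lambda>n. 2 powr sqrt (log 2 (real n))) \<longrightarrow>
       (\<exists>(\<eta>2 :: nat \<Rightarrow> real) \<theta> :: nat \<Rightarrow> real. \<eta>2 \<longlonglongrightarrow> 0 \<and> \<theta> \<longlonglongrightarrow> 0 \<and>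
         (\<forall>\<^sub>F n in sequentially. \<forall>m. \<forall>G :: 'a pair_pre_digraph. G \<in> vt_graphs n m \<and>
            ereal (real m) * diam (with_proj G) \<ge>
              ereal (3 * real_of_int (\<omega> n) * 2 powr ((1 - \<eta> n) * sqrt (log 2 (real n)))
                * sqrt (log 2 (real n))) \<longrightarrow>
            real (cop_number (with_proj G)) \<le>
              real n / 2 powr ((1 - \<eta>2 n) * sqrt (log 2 (real n)))
                * ((1 - \<theta> n) / (3 * real_of_int (\<omega> n)))) \<and>
         (\<lambda>n. real n / 2 powr ((1 - \<eta>2 n) * sqrt (log 2 (real n)))
                * ((1 - \<theta> n) / (3 * real_of_int (\<omega> n))))
           \<in> o[sequentially](\<lambda>n. real n / 2 powr ((1 - \<eta>2 n) * sqrt (log 2 (real n))))))"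
proof -
  define s where "s n = sqrt (log 2 (real n))" for n :: nat
  \<comment> \<open>The common error term: \<open>\<xi>\<close> exceeds \<open>\<eta>\<close> by exactly what absorbs the factor \<open>15 (1 + ln n)\<close>.\<close>
  define \<xi> where "\<xi> n = \<eta> n + log 2 (15 * (1 + ln (real n))) / s n" for n :: nat
  define B where "B n = real n / 2 powr ((1 - \<xi> n) * s n)" for n :: nat
  define W where "W n = real_of_int (\<omega> n)" for n :: nat
  have \<xi>: "\<xi> \<longlonglongrightarrow> 0"
    using tendsto_add[OF assms(3) log_factor_subexponential] by (simp add: \<xi>_def[abs_def] s_def)
  have W: "filterlim W at_top sequentially"
    unfolding W_def by (rule filterlim_compose[OF filterlim_real_of_int_at_top assms(2)])
  have s: "filterlim s at_top sequentially"
    unfolding s_def by real_asymp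
  have ev: "\<forall>\<^sub>F n in sequentially. n \<ge> 1 \<and> W n \<ge> 2 \<and> s n \<ge> 1"
    using W s unfolding filterlim_at_top by (intro eventually_conj eventually_ge_at_top) blast+
  have bound: "real (cop_number (with_proj G)) \<le> B n / (3 * W n * s n)"
    if n: "n \<ge> 1" "W n \<ge> 2" "s n \<ge> 1" and G: "G \<in> vt_graphs n m"
      "ereal (3 * W n * 2 powr ((1 - \<eta> n) * s n) * s n) \<le> ereal (real m) * diam (with_proj G)"
    for n m and G :: "'a pair_pre_digraph"
  proof -
    let ?C = "15 * (1 + ln (real n))" and ?p = "2 powr ((1 - \<eta> n) * s n)"
    have C: "?C > 0" using n(1) by (simp add: add_pos_nonneg)
    have "(1 - \<xi> n) * s n = (1 - \<eta> n) * s n - log 2 ?C"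
      using n(3) by (simp add: \<xi>_def field_simps)
    hence "2 powr ((1 - \<xi> n) * s n) = ?p / ?C"
      using C by (simp only: powr_diff) simp
    hence B: "B n = n * ?C / ?p" by (simp add: B_def)
    have "real (cop_number (with_proj G)) \<le> 15 * real n * (1 + ln n) / (3 * W n * ?p * s n)"
      using n G by (intro cop_number_vertex_transitive) auto
    also have "\<dots> = B n / (3 * W n * s n)" unfolding B by (simp add: mult_ac)
    finally show ?thesis .
  qed
  have Bpos: "B n \<ge> 0" for n by (simp add: B_def)
  have part1: "\<forall>\<^sub>F n in sequentially. \<forall>m. \<forall>G :: 'a pair_pre_digraph. G \<in> vt_graphs n m \<and>
      ereal (real m) * diam (with_proj G) \<ge> ereal (3 * W n * 2 powr ((1 - \<eta> n) * s n) * s n) \<longrightarrow>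
      real (cop_number (with_proj G)) \<le> B n * (3 * log 2 (W n) / (3 * W n * s n))"
    using ev
  proof eventually_elim
    case (elim n)
    hence "log 2 2 \<le> log 2 (W n)" by (subst log_le_cancel_iff) auto
    hence "1 \<le> 3 * log 2 (W n)" by simp
    hence "B n * 1 / (3 * W n * s n) \<le> B n * (3 * log 2 (W n)) / (3 * W n * s n)"
      using elim Bpos by (intro divide_right_mono mult_left_mono) auto
    thus ?case using bound[of n] elim by (fastforce intro: order_trans)
  qed
  have part2: "\<forall>\<^sub>F n in sequentially. \<forall>m. \<forall>G :: 'a pair_pre_digraph. G \<in> vt_graphs n m \<and>
      ereal (real m) * diam (with_proj G) \<ge> ereal (3 * W n * 2 powr ((1 - \<eta> n) * s n) * s n) \<longrightarrow>
      real (cop_number (with_proj G)) \<le> B n * ((1 - 0) / (3 * W n))"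
    using ev
  proof eventually_elim
    case (elim n)
    hence "B n / (3 * W n * s n) \<le> B n / (3 * W n * 1)"
      using Bpos by (intro divide_left_mono mult_left_mono) auto
    thus ?case using bound[of n] elim by (fastforce intro: order_trans)
  qed
  have "((\<lambda>x::real. log 2 x / x) \<longlongrightarrow> 0) at_top" by real_asymp
  from filterlim_compose[OF this W] have "(\<lambda>n. log 2 (W n) / W n * inverse (s n)) \<longlonglongrightarrow> 0 * 0"
    by (rule tendsto_mult) (rule tendsto_inverse_0_at_top[OF s])
  hence small1: "(\<lambda>n. 3 * log 2 (W n) / (3 * W n * s n)) \<longlonglongrightarrow> 0"
    by (simp add: field_simps)
  have "((\<lambda>x::real. (1 - 0) / (3 * x)) \<longlongrightarrow> 0) at_top" by real_asymp
  from filterlim_compose[OF this W] have small2: "(\<lambda>n. (1 - 0) / (3 * W n)) \<longlonglongrightarrow> 0" .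
  show ?thesis
  proof (intro conjI impI)
    show "\<exists>\<eta>1. \<eta>1 \<longlonglongrightarrow> 0 \<and>
         (\<forall>\<^sub>F n in sequentially. \<forall>m. \<forall>G :: 'a pair_pre_digraph. G \<in> vt_graphs n m \<and>
            ereal (real m) * diam (with_proj G) \<ge>
              ereal (3 * real_of_int (\<omega> n) * 2 powr ((1 - \<eta> n) * sqrt (log 2 (real n)))
                * sqrt (log 2 (real n))) \<longrightarrow>
            real (cop_number (with_proj G)) \<le>
              real n / 2 powr ((1 - \<eta>1 n) * sqrt (log 2 (real n)))
                * (3 * log 2 (real_of_int (\<omega> n)) / (3 * real_of_int (\<omega> n) * sqrt (log 2 (real n))))) \<and>
         (\<lambda>n. real n / 2 powr ((1 - \<eta>1 n) * sqrt (log 2 (real n)))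
                * (3 * log 2 (real_of_int (\<omega> n)) / (3 * real_of_int (\<omega> n) * sqrt (log 2 (real n)))))
           \<in> o[sequentially](\<lambda>n. real n / 2 powr ((1 - \<eta>1 n) * sqrt (log 2 (real n))))"
      using \<xi> part1 smallo_mult_null[OF small1, of B] unfolding B_def[abs_def] s_def[abs_def] W_def[abs_def] by blast
    show "\<exists>\<eta>2 \<theta>. \<eta>2 \<longlonglongrightarrow> 0 \<and> \<theta> \<longlonglongrightarrow> 0 \<and>
         (\<forall>\<^sub>F n in sequentially. \<forall>m. \<forall>G :: 'a pair_pre_digraph. G \<in> vt_graphs n m \<and>
            ereal (real m) * diam (with_proj G) \<ge>
              ereal (3 * real_of_int (\<omega> n) * 2 powr ((1 - \<eta> n) * sqrt (log 2 (real n)))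
                * sqrt (log 2 (real n))) \<longrightarrow>
            real (cop_number (with_proj G)) \<le>
              real n / 2 powr ((1 - \<eta>2 n) * sqrt (log 2 (real n)))
                * ((1 - \<theta> n) / (3 * real_of_int (\<omega> n)))) \<and>
         (\<lambda>n. real n / 2 powr ((1 - \<eta>2 n) * sqrt (log 2 (real n)))
                * ((1 - \<theta> n) / (3 * real_of_int (\<omega> n))))
           \<in> o[sequentially](\<lambda>n. real n / 2 powr ((1 - \<eta>2 n) * sqrt (log 2 (real n))))"
      using \<xi> part2 smallo_mult_null[OF small2, of B] unfolding B_def[abs_def] s_def[abs_def] W_def[abs_def]
      by (intro exI[of _ \<xi>] exI[of _ "\<lambda>_. 0"] conjI tendsto_const)
  qed
qed

end
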